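(* If a sequent $\Gamma\vdash\Delta$ is derivable in $LS_{BBI}$, then it is derivable in $LS_{BBI}$ without using the cut rule.
   Context: BBI formulae: $A ::= p \mid \top \mid \bot \mid \neg A \mid A\lor A \mid A\land A \mid A\to A \mid \top^* \mid A * A \mid A \mathrel{-\!*} A$, $p$ atomic; $\neg A$ abbreviates $A\to\bot$ and $A\lor B$ abbreviates $\neg(\neg A\land\neg B)$. Labels are label variables (from an infinite set $LVar$) or the constant $\epsilon$. A labelled formula is $w:A$; a relational atom is $(x,y\triangleright z)$ for labels $x,y,z$. A sequent $\Gamma\vdash\Delta$ has $\Gamma$ a finite multiset of labelled formulae and relational atoms and $\Delta$ a finite multiset of labelled formulae; ";" is multiset union. $\Gamma[y/x]$ replaces every occurrence of label $x$ by $y$. Rules of $LS_{BBI}$ ("from premises infer conclusion"; $P$ atomic): id: infer $\Gamma;w:P\vdash w:P;\Delta$. $\bot L$: infer $\Gamma;w:\bot\vdash\Delta$. $\top R$: infer $\Gamma\vdash w:\top;\Delta$. $\top^*R$: infer $\Gamma\vdash\epsilon:\top^*;\Delta$. cut: from $\Gamma\vdash x:A;\Delta$ and $\Gamma';x:A\vdash\Delta'$ infer $\Gamma;\Gamma'\vdash\Delta;\Delta'$. $\top^*L$: from $\Gamma[\epsilon/w]\vdash\Delta[\epsilon/w]$ infer $\Gamma;w:\top^*\vdash\Delta$ ($w\neq\epsilon$). $\land L$: from $\Gamma;w:A;w:B\vdash\Delta$ infer $\Gamma;w:A\land B\vdash\Delta$. $\land R$: from $\Gamma\vdash w:A;\Delta$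 and $\Gamma\vdash w:B;\Delta$ infer $\Gamma\vdash w:A\land B;\Delta$. $\to L$: from $\Gamma\vdash w:A;\Delta$ and $\Gamma;w:B\vdash\Delta$ infer $\Gamma;w:A\to B\vdash\Delta$. $\to R$: from $\Gamma;w:A\vdash w:B;\Delta$ infer $\Gamma\vdash w:A\to B;\Delta$. $*L$: from $(x,y\triangleright z);\Gamma;x:A;y:B\vdash\Delta$ infer $\Gamma;z:A*B\vdash\Delta$ ($x,y$ not in the conclusion). $\mathrel{-\!*}R$: from $(x,y\triangleright z);\Gamma;x:A\vdash z:B;\Delta$ infer $\Gamma\vdash y:A\mathrel{-\!*}B;\Delta$ ($x,z$ not in the conclusion). $*R$: from $(x,y\triangleright z);\Gamma\vdash x:A;z:A*B;\Delta$ and $(x,y\triangleright z);\Gamma\vdash y:B;z:A*B;\Delta$ infer $(x,y\triangleright z);\Gamma\vdash z:A*B;\Delta$. $\mathrel{-\!*}L$: from $(x,y\triangleright z);\Gamma;y:A\mathrel{-\!*}B\vdash x:A;\Delta$ and $(x,y\triangleright z);\Gamma;y:A\mathrel{-\!*}B;z:B\vdash\Delta$ infer $(x,y\triangleright z);\Gamma;y:A\mathrel{-\!*}B\vdash\Delta$. E: from $(y,x\triangleright z);(x,y\triangleright z);\Gamma\vdash\Delta$ infer $(x,y\triangleright z);\Gamma\vdash\Delta$. U: from $(x,\epsilon\triangleright x);\Gamma\vdash\Delta$ infer $\Gamma\vdash\Delta$. A: from $(u,w\triangleright z);(y,v\triangleright w);(x,y\triangleright z);(u,v\triangleright x);\Gamma\vdash\Delta$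 infer $(x,y\triangleright z);(u,v\triangleright x);\Gamma\vdash\Delta$ ($w$ not in the conclusion). $A_C$: from $(x,w\triangleright x);(y,y\triangleright w);(x,y\triangleright x);\Gamma\vdash\Delta$ infer $(x,y\triangleright x);\Gamma\vdash\Delta$ ($w$ not in the conclusion). $Eq_1$: from $(\epsilon,w'\triangleright w');\Gamma[w'/w]\vdash\Delta[w'/w]$ infer $(\epsilon,w\triangleright w');\Gamma\vdash\Delta$ ($w\neq\epsilon$). $Eq_2$: from $(\epsilon,w'\triangleright w');\Gamma[w'/w]\vdash\Delta[w'/w]$ infer $(\epsilon,w'\triangleright w);\Gamma\vdash\Delta$ ($w\neq\epsilon$). *)

theory Defs
  imports Main "HOL-Library.Multiset" "HOL-Library.Infinite_Typeclass"
begin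

datatype 'p form =
    Atom 'p
  | Top  ("\<^bold>\<top>")
  | Bot  ("\<^bold>\<bottom>")
  | And "'p form" "'p form"  (infixr "\<^bold>\<and>" 66)
  | Imp "'p form" "'p form"  (infixr "\<^bold>\<rightarrow>" 64)
  | MTop  ("\<^bold>\<top>\<^sup>*")
  | Star "'p form" "'p form"  (infixr "\<^bold>*" 67)
  | Wand "'p form" "'p form"  (infixr "\<^bold>-\<^bold>*" 64)

abbreviation Neg :: "'p form \<Rightarrow> 'p form"  ("\<^bold>\<not> _" [68] 68) where
  "\<^bold>\<not> A \<equiv> A \<^bold>\<rightarrow> \<^bold>\<bottom>"

abbreviation Or :: "'p form \<Rightarrow> 'p form \<Rightarrow> 'p form"  (infixr "\<^bold>\<or>" 65) where
  "A \<^bold>\<or> B \<equiv> \<^bold>\<not> (\<^bold>\<not> A \<^bold>\<and> \<^bold>\<not> B)"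

text \<open>The type \<open>'v\<close> plays the role of the set of label variables; it is required to be
  infinite only where this matters, through the class \<open>infinite\<close>.\<close>

datatype 'v label = Eps ("\<epsilon>") | LVar 'v

datatype ('p, 'v) lform = LForm "'v label" "'p form"  (infix "\<^bold>:" 55)

text \<open>Antecedents mix labelled formulae and relational atoms; succedents contain labelled
  formulae only.\<close>

datatype ('p, 'v) ant =
    Fm "('p, 'v) lform"
  | Rel "'v label" "'v label" "'v label"  ("\<lparr>_, _ \<triangleright> _\<rparr>")

primrec lform_labels :: "('p, 'v) lform \<Rightarrow> 'v label set" where
  "lform_labels (w \<^bold>: A) = {w}"

primrec ant_labels :: "('p, 'v) ant \<Rightarrow> 'v label set" where
  "ant_labels (Fm \<phi>) = lform_labels \<phi>"
| "ant_labels \<lparr>x, y \<triangleright> z\<rparr> = {x, y, z}"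

definition seq_labels :: "('p, 'v) ant multiset \<Rightarrow> ('p, 'v) lform multiset \<Rightarrow> 'v label set" where
  "seq_labels \<Gamma> \<Delta> = (\<Union>a \<in> set_mset \<Gamma>. ant_labels a) \<union> (\<Union>\<phi> \<in> set_mset \<Delta>. lform_labels \<phi>)"

text \<open>In all substitution functions the arguments are ordered as in \<open>[y/x]\<close>: the first
  label replaces the second.\<close>

definition subst_label :: "'v label \<Rightarrow> 'v label \<Rightarrow> 'v label \<Rightarrow> 'v label" where
  "subst_label y x l = (if l = x then y else l)"

primrec subst_lform :: "'v label \<Rightarrow> 'v label \<Rightarrow> ('p, 'v) lform \<Rightarrow> ('p, 'v) lform" where
  "subst_lform y x (w \<^bold>: A) = (subst_label y x w \<^bold>: A)"

primrec subst_ant :: "'v label \<Rightarrow> 'v label \<Rightarrow> ('p, 'v) ant \<Rightarrow> ('p, 'v) ant" where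
  "subst_ant y x (Fm \<phi>) = Fm (subst_lform y x \<phi>)"
| "subst_ant y x \<lparr>u, v \<triangleright> w\<rparr> = \<lparr>subst_label y x u, subst_label y x v \<triangleright> subst_label y x w\<rparr>"

abbreviation subst_Ant ::
    "('p, 'v) ant multiset \<Rightarrow> 'v label \<Rightarrow> 'v label \<Rightarrow> ('p, 'v) ant multiset"
    ("_[_'/_]\<^sub>L" [1000, 0, 0] 1000) where
  "\<Gamma>[y/x]\<^sub>L \<equiv> image_mset (subst_ant y x) \<Gamma>"

abbreviation subst_Suc ::
    "('p, 'v) lform multiset \<Rightarrow> 'v label \<Rightarrow> 'v label \<Rightarrow> ('p, 'v) lform multiset"
    ("_[_'/_]\<^sub>R" [1000, 0, 0] 1000) where
  "\<Delta>[y/x]\<^sub>R \<equiv> image_mset (subst_lform y x) \<Delta>"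

text \<open>The parameter \<open>c\<close> says whether the cut rule may be used. Labels required not to occur
  in the conclusion are label variables, never \<open>\<epsilon>\<close>, and two of them introduced by one rule
  are distinct; otherwise the rules would be unsound. All other labels are arbitrary and may
  coincide. The side condition that a replaced label differs from \<open>\<epsilon>\<close> is expressed by
  writing it as \<open>LVar w\<close>.\<close>

inductive derivable ::
    "bool \<Rightarrow> ('p, 'v) ant multiset \<Rightarrow> ('p, 'v) lform multiset \<Rightarrow> bool" for c :: bool where
  Id: "derivable c (add_mset (Fm (w \<^bold>: Atom P)) \<Gamma>) (add_mset (w \<^bold>: Atom P) \<Delta>)"
| BotL: "derivable c (add_mset (Fm (w \<^bold>: \<^bold>\<bottom>)) \<Gamma>) \<Delta>"
| TopR: "derivable c \<Gamma> (add_mset (w \<^bold>: \<^bold>\<top>) \<Delta>)"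
| MTopR: "derivable c \<Gamma> (add_mset (\<epsilon> \<^bold>: \<^bold>\<top>\<^sup>*) \<Delta>)"
| Cut: "c \<Longrightarrow>
    derivable c \<Gamma> (add_mset (x \<^bold>: A) \<Delta>) \<Longrightarrow>
    derivable c (add_mset (Fm (x \<^bold>: A)) \<Gamma>') \<Delta>' \<Longrightarrow>
    derivable c (\<Gamma> + \<Gamma>') (\<Delta> + \<Delta>')"
| MTopL: "derivable c (\<Gamma>[\<epsilon>/LVar w]\<^sub>L) (\<Delta>[\<epsilon>/LVar w]\<^sub>R) \<Longrightarrow>
    derivable c (add_mset (Fm (LVar w \<^bold>: \<^bold>\<top>\<^sup>*)) \<Gamma>) \<Delta>"
| AndL: "derivable c (add_mset (Fm (w \<^bold>: A)) (add_mset (Fm (w \<^bold>: B)) \<Gamma>)) \<Delta> \<Longrightarrow>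
    derivable c (add_mset (Fm (w \<^bold>: A \<^bold>\<and> B)) \<Gamma>) \<Delta>"
| AndR: "derivable c \<Gamma> (add_mset (w \<^bold>: A) \<Delta>) \<Longrightarrow>
    derivable c \<Gamma> (add_mset (w \<^bold>: B) \<Delta>) \<Longrightarrow>
    derivable c \<Gamma> (add_mset (w \<^bold>: A \<^bold>\<and> B) \<Delta>)"
| ImpL: "derivable c \<Gamma> (add_mset (w \<^bold>: A) \<Delta>) \<Longrightarrow>
    derivable c (add_mset (Fm (w \<^bold>: B)) \<Gamma>) \<Delta> \<Longrightarrow>
    derivable c (add_mset (Fm (w \<^bold>: A \<^bold>\<rightarrow> B)) \<Gamma>) \<Delta>"
| ImpR: "derivable c (add_mset (Fm (w \<^bold>: A)) \<Gamma>) (add_mset (w \<^bold>: B) \<Delta>) \<Longrightarrow>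
    derivable c \<Gamma> (add_mset (w \<^bold>: A \<^bold>\<rightarrow> B) \<Delta>)"
| StarL: "derivable c
      (add_mset \<lparr>LVar x, LVar y \<triangleright> z\<rparr>
        (add_mset (Fm (LVar x \<^bold>: A)) (add_mset (Fm (LVar y \<^bold>: B)) \<Gamma>))) \<Delta> \<Longrightarrow>
    x \<noteq> y \<Longrightarrow>
    LVar x \<notin> seq_labels (add_mset (Fm (z \<^bold>: A \<^bold>* B)) \<Gamma>) \<Delta> \<Longrightarrow>
    LVar y \<notin> seq_labels (add_mset (Fm (z \<^bold>: A \<^bold>* B)) \<Gamma>) \<Delta> \<Longrightarrow>
    derivable c (add_mset (Fm (z \<^bold>: A \<^bold>* B)) \<Gamma>) \<Delta>"
| WandR: "derivable c
      (add_mset \<lparr>LVar x, y \<triangleright> LVar z\<rparr> (add_mset (Fm (LVar x \<^bold>: A)) \<Gamma>))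
      (add_mset (LVar z \<^bold>: B) \<Delta>) \<Longrightarrow>
    x \<noteq> z \<Longrightarrow>
    LVar x \<notin> seq_labels \<Gamma> (add_mset (y \<^bold>: A \<^bold>-\<^bold>* B) \<Delta>) \<Longrightarrow>
    LVar z \<notin> seq_labels \<Gamma> (add_mset (y \<^bold>: A \<^bold>-\<^bold>* B) \<Delta>) \<Longrightarrow>
    derivable c \<Gamma> (add_mset (y \<^bold>: A \<^bold>-\<^bold>* B) \<Delta>)"
| StarR: "derivable c (add_mset \<lparr>x, y \<triangleright> z\<rparr> \<Gamma>)
      (add_mset (x \<^bold>: A) (add_mset (z \<^bold>: A \<^bold>* B) \<Delta>)) \<Longrightarrow>
    derivable c (add_mset \<lparr>x, y \<triangleright> z\<rparr> \<Gamma>)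
      (add_mset (y \<^bold>: B) (add_mset (z \<^bold>: A \<^bold>* B) \<Delta>)) \<Longrightarrow>
    derivable c (add_mset \<lparr>x, y \<triangleright> z\<rparr> \<Gamma>) (add_mset (z \<^bold>: A \<^bold>* B) \<Delta>)"
| WandL: "derivable c
      (add_mset \<lparr>x, y \<triangleright> z\<rparr> (add_mset (Fm (y \<^bold>: A \<^bold>-\<^bold>* B)) \<Gamma>))
      (add_mset (x \<^bold>: A) \<Delta>) \<Longrightarrow>
    derivable c
      (add_mset \<lparr>x, y \<triangleright> z\<rparr>
        (add_mset (Fm (y \<^bold>: A \<^bold>-\<^bold>* B)) (add_mset (Fm (z \<^bold>: B)) \<Gamma>))) \<Delta> \<Longrightarrow>
    derivable c (add_mset \<lparr>x, y \<triangleright> z\<rparr> (add_mset (Fm (y \<^bold>: A \<^bold>-\<^bold>* B)) \<Gamma>)) \<Delta>"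
| E: "derivable c (add_mset \<lparr>y, x \<triangleright> z\<rparr> (add_mset \<lparr>x, y \<triangleright> z\<rparr> \<Gamma>)) \<Delta> \<Longrightarrow>
    derivable c (add_mset \<lparr>x, y \<triangleright> z\<rparr> \<Gamma>) \<Delta>"
| U: "derivable c (add_mset \<lparr>x, \<epsilon> \<triangleright> x\<rparr> \<Gamma>) \<Delta> \<Longrightarrow> derivable c \<Gamma> \<Delta>"
| A: "derivable c
      (add_mset \<lparr>u, LVar w \<triangleright> z\<rparr> (add_mset \<lparr>y, v \<triangleright> LVar w\<rparr>
        (add_mset \<lparr>x, y \<triangleright> z\<rparr> (add_mset \<lparr>u, v \<triangleright> x\<rparr> \<Gamma>)))) \<Delta> \<Longrightarrow>
    LVar w \<notin> seq_labels (add_mset \<lparr>x, y \<triangleright> z\<rparr> (add_mset \<lparr>u, v \<triangleright> x\<rparr> \<Gamma>)) \<Delta> \<Longrightarrow>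
    derivable c (add_mset \<lparr>x, y \<triangleright> z\<rparr> (add_mset \<lparr>u, v \<triangleright> x\<rparr> \<Gamma>)) \<Delta>"
| A_C: "derivable c
      (add_mset \<lparr>x, LVar w \<triangleright> x\<rparr> (add_mset \<lparr>y, y \<triangleright> LVar w\<rparr>
        (add_mset \<lparr>x, y \<triangleright> x\<rparr> \<Gamma>))) \<Delta> \<Longrightarrow>
    LVar w \<notin> seq_labels (add_mset \<lparr>x, y \<triangleright> x\<rparr> \<Gamma>) \<Delta> \<Longrightarrow>
    derivable c (add_mset \<lparr>x, y \<triangleright> x\<rparr> \<Gamma>) \<Delta>"
| Eq1: "derivable c (add_mset \<lparr>\<epsilon>, w' \<triangleright> w'\<rparr> (\<Gamma>[w'/LVar w]\<^sub>L)) (\<Delta>[w'/LVar w]\<^sub>R) \<Longrightarrow>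
    derivable c (add_mset \<lparr>\<epsilon>, LVar w \<triangleright> w'\<rparr> \<Gamma>) \<Delta>"
| Eq2: "derivable c (add_mset \<lparr>\<epsilon>, w' \<triangleright> w'\<rparr> (\<Gamma>[w'/LVar w]\<^sub>L)) (\<Delta>[w'/LVar w]\<^sub>R) \<Longrightarrow>
    derivable c (add_mset \<lparr>\<epsilon>, w' \<triangleright> LVar w\<rparr> \<Gamma>) \<Delta>"

abbreviation LS_BBI :: "('p, 'v) ant multiset \<Rightarrow> ('p, 'v) lform multiset \<Rightarrow> bool" where
  "LS_BBI \<equiv> derivable True"

abbreviation LS_BBI_cut_free :: "('p, 'v) ant multiset \<Rightarrow> ('p, 'v) lform multiset \<Rightarrow> bool" where
  "LS_BBI_cut_free \<equiv> derivable False"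

end

theory Submission
  imports Defs
begin

text \<open>
  The calculus is replaced by one in which every premise is required under all label maps
  \<open>\<theta>\<close> fixing \<open>\<epsilon>\<close>, and in which an eigenvariable is instantiated by all labels.
  There are no freshness conditions, closure under label substitution needs no induction,
  and \<open>\<top>\<^sup>*L\<close>, \<open>Eq\<^sub>1\<close>, \<open>Eq\<^sub>2\<close> just restrict \<open>\<theta>\<close>. Each rule either
  consumes a single principal formula and is invertible, or keeps its principal items. Inversion
  and the permutation of cuts are instances of one replacement lemma; contraction and cut follow by
  induction on formulae. Picking fresh eigenvariables and a most general \<open>\<theta>\<close> leads
  back to the original calculus without cut.
\<close>

section \<open>Items and label maps\<close>

text \<open>Both sides of a sequent go into one multiset, with \<open>L\<close> for the antecedent
  and \<open>R\<close> for the succedent, so that inversion, contraction and the permutation of cuts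
  need no left and right versions.\<close>

datatype ('p, 'v) item =
    L "'v label" "'p form"
  | R "'v label" "'p form"
  | T "'v label" "'v label" "'v label"

primrec rn :: "('v label \<Rightarrow> 'v label) \<Rightarrow> ('p, 'v) item \<Rightarrow> ('p, 'v) item" where
  "rn \<theta> (L w A) = L (\<theta> w) A"
| "rn \<theta> (R w A) = R (\<theta> w) A"
| "rn \<theta> (T x y z) = T (\<theta> x) (\<theta> y) (\<theta> z)"

abbreviation rns ::
    "('v label \<Rightarrow> 'v label) \<Rightarrow> ('p, 'v) item multiset \<Rightarrow> ('p, 'v) item multiset" where
  "rns \<theta> \<equiv> image_mset (rn \<theta>)"

text \<open>Relational atoms weigh less than every formula, so the atoms introduced by decomposing a
  star or a wand fall under the induction hypothesis of contraction.\<close>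

primrec weight :: "('p, 'v) item \<Rightarrow> nat" where
  "weight (L w A) = size A + 1"
| "weight (R w A) = size A + 1"
| "weight (T x y z) = 0"

lemma weight_rn [simp]: "weight (rn \<theta> \<phi>) = weight \<phi>"
  by (cases \<phi>) auto

lemma rn_rn [simp]: "rn \<eta> (rn \<theta> \<phi>) = rn (\<eta> \<circ> \<theta>) \<phi>"
  by (cases \<phi>) auto

lemma rn_comp [simp]: "rn \<eta> \<circ> rn \<theta> = rn (\<eta> \<circ> \<theta>)"
  by auto

lemma rn_id [simp]: "rn id \<phi> = \<phi>"
  by (cases \<phi>) auto

lemma rn_id' [simp]: "rn id = id"
  by auto

lemma rns_rns [simp]: "rns \<eta> (rns \<theta> S) = rns (\<eta> \<circ> \<theta>) S"
  by (simp add: multiset.map_comp)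

section \<open>A calculus closed under renaming\<close>

text \<open>\<open>F \<theta>\<close> is the set of premises owed at \<open>\<theta>\<close>; where
  it is empty nothing has to be proved. This makes \<open>BotL\<close> and \<open>TopR\<close>
  axioms and lets \<open>MTopL\<close> ask only for the maps that send \<open>w\<close> to
  \<open>\<epsilon>\<close>. \<open>StarL\<close> and \<open>WandR\<close> owe one premise for each
  pair of labels.\<close>

inductive decomp ::
    "('p, 'v) item \<Rightarrow> (('v label \<Rightarrow> 'v label) \<Rightarrow> ('p, 'v) item multiset set) \<Rightarrow> bool" where
  BotL: "decomp (L w \<^bold>\<bottom>) (\<lambda>\<theta>. {})"
| TopR: "decomp (R w \<^bold>\<top>) (\<lambda>\<theta>. {})"
| MTopL: "decomp (L w \<^bold>\<top>\<^sup>*) (\<lambda>\<theta>. {Q. Q = {#} \<and> \<theta> w = \<epsilon>})"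
| AndL: "decomp (L w (A \<^bold>\<and> B)) (\<lambda>\<theta>. {{#L (\<theta> w) A, L (\<theta> w) B#}})"
| AndR: "decomp (R w (A \<^bold>\<and> B)) (\<lambda>\<theta>. {{#R (\<theta> w) A#}, {#R (\<theta> w) B#}})"
| ImpL: "decomp (L w (A \<^bold>\<rightarrow> B)) (\<lambda>\<theta>. {{#R (\<theta> w) A#}, {#L (\<theta> w) B#}})"
| ImpR: "decomp (R w (A \<^bold>\<rightarrow> B)) (\<lambda>\<theta>. {{#L (\<theta> w) A, R (\<theta> w) B#}})"
| StarL: "decomp (L z (A \<^bold>* B)) (\<lambda>\<theta>. {Q. \<exists>x y. Q = {#T x y (\<theta> z), L x A, L y B#}})"
| WandR: "decomp (R y (A \<^bold>-\<^bold>* B)) (\<lambda>\<theta>. {Q. \<exists>x z. Q = {#T x (\<theta> y) z, L x A, R z B#}})"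

text \<open>Premises list only the items added to the context, which contains the principal items.
  These form a set: a single copy of \<open>(x, y \<triangleright> x)\<close> may serve as both principal atoms of
  \<open>A\<close>, which yields \<open>A\<^sub>C\<close>.\<close>

inductive extend ::
    "('p, 'v) item set \<Rightarrow> (('v label \<Rightarrow> 'v label) \<Rightarrow> ('p, 'v) item multiset set) \<Rightarrow> bool" where
  Id: "extend {L w (Atom p), R w (Atom p)} (\<lambda>\<theta>. {})"
| MTopR: "extend {R \<epsilon> \<^bold>\<top>\<^sup>*} (\<lambda>\<theta>. {})"
| StarR: "extend {T x y z, R z (A \<^bold>* B)} (\<lambda>\<theta>. {{#R (\<theta> x) A#}, {#R (\<theta> y) B#}})"
| WandL: "extend {T x y z, L y (A \<^bold>-\<^bold>* B)} (\<lambda>\<theta>. {{#R (\<theta> x) A#}, {#L (\<theta> z) B#}})"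
| E: "extend {T x y z} (\<lambda>\<theta>. {{#T (\<theta> y) (\<theta> x) (\<theta> z)#}})"
| U: "extend {} (\<lambda>\<theta>. {{#T (\<theta> x) \<epsilon> (\<theta> x)#}})"
| A: "extend {T x y z, T u v x}
    (\<lambda>\<theta>. {Q. \<exists>w. Q = {#T (\<theta> u) w (\<theta> z), T (\<theta> y) (\<theta> v) w#}})"
| Eq: "extend {T \<epsilon> w w'} (\<lambda>\<theta>. {Q. Q = {#} \<and> \<theta> w = \<theta> w'})"

inductive deriv :: "('p, 'v) item multiset \<Rightarrow> bool" where
  decomp: "decomp \<phi> F \<Longrightarrow>
    (\<And>\<theta> Q. \<theta> \<epsilon> = \<epsilon> \<Longrightarrow> Q \<in> F \<theta> \<Longrightarrow> deriv (rns \<theta> S + Q)) \<Longrightarrow> deriv (add_mset \<phi> S)"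
| extend: "extend P F \<Longrightarrow> P \<subseteq> set_mset S \<Longrightarrow>
    (\<And>\<theta> Q. \<theta> \<epsilon> = \<epsilon> \<Longrightarrow> Q \<in> F \<theta> \<Longrightarrow> deriv (rns \<theta> S + Q)) \<Longrightarrow> deriv S"

section \<open>Renaming and weakening\<close>

lemma decomp_rn: "decomp \<phi> F \<Longrightarrow> decomp (rn \<eta> \<phi>) (\<lambda>\<theta>. F (\<theta> \<circ> \<eta>))"
  by (erule decomp.cases) (simp_all add: decomp.intros)

lemma extend_rn: "extend P F \<Longrightarrow> \<eta> \<epsilon> = \<epsilon> \<Longrightarrow> extend (rn \<eta> ` P) (\<lambda>\<theta>. F (\<theta> \<circ> \<eta>))"
  by (erule extend.cases) (simp_all add: extend.intros)

text \<open>For \<open>StarL\<close> and \<open>WandR\<close> this works because their premises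
  range over all labels, for \<open>MTopL\<close> because \<open>\<theta>\<close> fixes
  \<open>\<epsilon>\<close>.\<close>

lemma decomp_premise_rn:
  "decomp \<phi> F \<Longrightarrow> Q \<in> F \<eta> \<Longrightarrow> \<theta> \<epsilon> = \<epsilon> \<Longrightarrow> rns \<theta> Q \<in> F (\<theta> \<circ> \<eta>)"
  by (erule decomp.cases) (auto, blast+)

lemma decomp_functional: "decomp \<phi> F \<Longrightarrow> decomp \<phi> G \<Longrightarrow> F = G"
  by (erule decomp.cases; erule decomp.cases) simp_all

text \<open>Makes the \<open>extend\<close> case of inversion vacuous.\<close>

lemma decomp_extend_disjoint: "decomp \<phi> F \<Longrightarrow> extend P G \<Longrightarrow> \<phi> \<notin> P"
  by (erule decomp.cases; erule extend.cases) simp_all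

lemma decomp_weight: "decomp \<phi> F \<Longrightarrow> Q \<in> F \<theta> \<Longrightarrow> \<psi> \<in># Q \<Longrightarrow> weight \<psi> < weight \<phi>"
  by (erule decomp.cases) auto

text \<open>The premises that the renamed instance owes at \<open>\<theta>\<close> are those of the
  given instance at \<open>\<theta> \<circ> \<eta>\<close>, so looking at the last rule is
  enough.\<close>

lemma deriv_rename: "deriv S \<Longrightarrow> \<eta> \<epsilon> = \<epsilon> \<Longrightarrow> deriv (rns \<eta> S)"
proof (erule deriv.cases)
  fix \<phi> F S'
  assume \<eta>: "\<eta> \<epsilon> = \<epsilon>" and S: "S = add_mset \<phi> S'" and d: "decomp \<phi> F"
    and prem: "\<And>\<theta> Q. \<theta> \<epsilon> = \<epsilon> \<Longrightarrow> Q \<in> F \<theta> \<Longrightarrow> deriv (rns \<theta> S' + Q)"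
  show ?thesis
    unfolding S using deriv.decomp[OF decomp_rn[OF d, of \<eta>], of "rns \<eta> S'"] prem \<eta> by simp
next
  fix P F S'
  assume \<eta>: "\<eta> \<epsilon> = \<epsilon>" and S: "S = S'" and e: "extend P F" and P: "P \<subseteq> set_mset S'"
    and prem: "\<And>\<theta> Q. \<theta> \<epsilon> = \<epsilon> \<Longrightarrow> Q \<in> F \<theta> \<Longrightarrow> deriv (rns \<theta> S' + Q)"
  show ?thesis
    unfolding S using deriv.extend[OF extend_rn[of P F \<eta>, OF e \<eta>], of "rns \<eta> S'"] prem \<eta> P
    by (simp add: image_mono)
qed

text \<open>No label can clash with an eigenvariable, so \<open>X\<close> joins every premise. It
  does so as \<open>rns \<theta> X\<close>, hence \<open>X\<close> is arbitrary in the
  induction.\<close>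

lemma deriv_weaken: "deriv S \<Longrightarrow> deriv (S + X)"
proof (induction arbitrary: X rule: deriv.induct)
  case (decomp \<phi> F S)
  have "deriv (add_mset \<phi> (S + X))"
  proof (rule deriv.decomp[OF decomp.hyps(1)])
    fix \<theta> :: "'b label \<Rightarrow> 'b label" and Q
    assume "\<theta> \<epsilon> = \<epsilon>" "Q \<in> F \<theta>"
    from decomp.IH[OF this, of "rns \<theta> X"] show "deriv (rns \<theta> (S + X) + Q)"
      by (simp add: ac_simps)
  qed
  then show ?case by simp
next
  case (extend P F S)
  show ?case
  proof (rule deriv.extend[OF extend.hyps(1)])
    show "P \<subseteq> set_mset (S + X)" using extend.hyps(2) by auto
  next
    fix \<theta> :: "'b label \<Rightarrow> 'b label" and Q
    assume "\<theta> \<epsilon> = \<epsilon>" "Q \<in> F \<theta>"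
    from extend.IH[OF this, of "rns \<theta> X"] show "deriv (rns \<theta> (S + X) + Q)"
      by (simp add: ac_simps)
  qed
qed

section \<open>Replacement of an item, and inversion\<close>

text \<open>Follow one occurrence of \<open>\<phi>\<close> up the derivation and put
  \<open>X\<close> in its place. As long as it is a side item the rule permutes, with
  \<open>\<phi>\<close> and \<open>X\<close> renamed in the premises. Only the steps where it is
  principal depend on \<open>M\<close>. In \<open>M_decomp\<close> it is gone from the premises; in
  \<open>M_extend\<close> it survives there and has already been replaced.\<close>

lemma deriv_replace:
  assumes M_rn: "\<And>\<phi> X \<theta>. M \<phi> X \<Longrightarrow> \<theta> \<epsilon> = \<epsilon> \<Longrightarrow> M (rn \<theta> \<phi>) (rns \<theta> X)"
    and M_decomp: "\<And>\<phi> X S F. M \<phi> X \<Longrightarrow> decomp \<phi> F \<Longrightarrow>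
      (\<And>\<theta> Q. \<theta> \<epsilon> = \<epsilon> \<Longrightarrow> Q \<in> F \<theta> \<Longrightarrow> deriv (rns \<theta> S + Q)) \<Longrightarrow> deriv (S + X)"
    and M_extend: "\<And>\<phi> X S P F. M \<phi> X \<Longrightarrow> extend P F \<Longrightarrow> \<phi> \<in> P \<Longrightarrow>
      P \<subseteq> insert \<phi> (set_mset S) \<Longrightarrow>
      (\<And>\<theta> Q. \<theta> \<epsilon> = \<epsilon> \<Longrightarrow> Q \<in> F \<theta> \<Longrightarrow> deriv (rns \<theta> (S + X) + Q)) \<Longrightarrow> deriv (S + X)"
    and "deriv (add_mset \<phi> S)" "M \<phi> X"
  shows "deriv (S + X)"
  using assms(4,5)
proof (induction "add_mset \<phi> S" arbitrary: \<phi> S X rule: deriv.induct)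
  case (decomp \<psi> F S' \<phi> S X)
  show ?case
  proof (cases "\<psi> = \<phi>")
    case True
    then have "S' = S" using decomp.hyps(4) by simp
    then show ?thesis using M_decomp[OF decomp.prems] decomp.hyps(1,2) True by blast
  next
    case False
    then obtain K where K: "S' = add_mset \<phi> K" "S = add_mset \<psi> K"
      using decomp.hyps(4) by (metis add_eq_conv_ex)
    have "deriv (add_mset \<psi> (K + X))"
    proof (rule deriv.decomp[OF decomp.hyps(1)])
      fix \<theta> :: "'b label \<Rightarrow> 'b label" and Q
      assume \<theta>: "\<theta> \<epsilon> = \<epsilon>" and "Q \<in> F \<theta>"
      from decomp.hyps(3)[OF this, of "rn \<theta> \<phi>" "rns \<theta> K + Q" "rns \<theta> X"]
      show "deriv (rns \<theta> (K + X) + Q)"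
        using M_rn[of \<phi> X \<theta>, OF decomp.prems \<theta>] by (simp add: K ac_simps)
    qed
    then show ?thesis by (simp add: K)
  qed
next
  case (extend P F \<phi> S X)
  have *: "deriv (rns \<theta> (S + X) + Q)" if \<theta>: "\<theta> \<epsilon> = \<epsilon>" and "Q \<in> F \<theta>" for \<theta> Q
    using extend.hyps(4)[OF that, of "rn \<theta> \<phi>" "rns \<theta> S + Q" "rns \<theta> X"]
      M_rn[of \<phi> X \<theta>, OF extend.prems \<theta>] by (simp add: ac_simps)
  show ?case
  proof (cases "\<phi> \<in> P")
    case True
    show ?thesis
      using M_extend[OF extend.prems extend.hyps(1) True _ *] extend.hyps(2) by simp
  next
    case False
    then have "P \<subseteq> set_mset (S + X)" using extend.hyps(2) by auto
    then show ?thesis using deriv.extend[OF extend.hyps(1) _ *] by simp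
  qed
qed

text \<open>Replace \<open>\<phi>\<close> by its premise \<open>Q\<close>. Where
  \<open>\<phi>\<close> is decomposed, \<open>Q\<close> is one of the premises given. The premise at
  \<open>id\<close> suffices: other maps are reached by inverting a renamed item with
  \<open>decomp_rn\<close>.\<close>

lemma deriv_invert:
  assumes "deriv (add_mset \<phi> S)" "decomp \<phi> F" "Q \<in> F id"
  shows "deriv (S + Q)"
proof (rule deriv_replace[where M = "\<lambda>\<phi> Q. \<exists>F. decomp \<phi> F \<and> Q \<in> F id"])
  fix \<phi> :: "('a, 'b) item" and X and \<theta> :: "'b label \<Rightarrow> 'b label"
  assume "\<exists>F. decomp \<phi> F \<and> X \<in> F id" and \<theta>: "\<theta> \<epsilon> = \<epsilon>"
  then obtain F where F: "decomp \<phi> F" "X \<in> F id" by blast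
  show "\<exists>F. decomp (rn \<theta> \<phi>) F \<and> rns \<theta> X \<in> F id"
    using decomp_rn[OF F(1), of \<theta>] decomp_premise_rn[of \<phi> F X id \<theta>, OF F \<theta>] by auto
next
  fix \<phi> :: "('a, 'b) item" and X S F
  assume "\<exists>F. decomp \<phi> F \<and> X \<in> F id" and F: "decomp \<phi> F"
    and *: "\<And>\<theta> Q. \<theta> \<epsilon> = \<epsilon> \<Longrightarrow> Q \<in> F \<theta> \<Longrightarrow> deriv (rns \<theta> S + Q)"
  then have "X \<in> F id" using decomp_functional by blast
  then show "deriv (S + X)" using *[of id X] by simp
next
  show "\<exists>F. decomp \<phi> F \<and> Q \<in> F id" using assms by blast
qed (use assms(1) in \<open>auto dest: decomp_extend_disjoint\<close>)

section \<open>Contraction\<close>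

lemma deriv_contract_mset:
  assumes "\<And>\<psi> S. \<psi> \<in># Q \<Longrightarrow> deriv (add_mset \<psi> (add_mset \<psi> S)) \<Longrightarrow> deriv (add_mset \<psi> S)"
    and "deriv (S + Q + Q)"
  shows "deriv (S + Q)"
  using assms
proof (induction Q arbitrary: S)
  case (add \<psi> Q)
  have "deriv (add_mset \<psi> (add_mset \<psi> (S + Q + Q)))" using add.prems(2) by simp
  then have "deriv (add_mset \<psi> (S + Q + Q))" by (rule add.prems(1)[rotated]) simp
  then have "deriv (add_mset \<psi> S + Q + Q)" by simp
  then have "deriv (add_mset \<psi> S + Q)" by (rule add.IH[rotated]) (simp add: add.prems(1))
  then show ?case by simp
qed simp

text \<open>If one copy is decomposed, invert the other one to get the premise \<open>Q\<close>
  twice. The items of \<open>Q\<close> weigh less and are contracted by the outer induction.\<close>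

lemma deriv_contract: "deriv (add_mset \<phi> (add_mset \<phi> S)) \<Longrightarrow> deriv (add_mset \<phi> S)"
proof (induction "weight \<phi>" arbitrary: \<phi> S rule: less_induct)
  case (less \<phi> S)
  \<comment> \<open>The inner induction renames the contracted item, so only its weight can be held
    fixed.\<close>
  have "deriv S' \<Longrightarrow> S' = add_mset \<psi> (add_mset \<psi> S) \<Longrightarrow> weight \<psi> = weight \<phi> \<Longrightarrow>
    deriv (add_mset \<psi> S)" for S' S and \<psi> :: "('a, 'b) item"
  proof (induction arbitrary: \<psi> S rule: deriv.induct)
    case (decomp \<chi> F S')
    show ?case
    proof (cases "\<chi> = \<psi>")
      case True
      with decomp.prems have S': "S' = add_mset \<psi> S" by simp
      show ?thesis
      proof (rule deriv.decomp)
        show dec: "decomp \<psi> F" using decomp.hyps True by simp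
        fix \<theta> :: "'b label \<Rightarrow> 'b label" and Q
        assume \<theta>: "\<theta> \<epsilon> = \<epsilon>" and Q: "Q \<in> F \<theta>"
        \<comment> \<open>The copy not decomposed is still in the premise, renamed by
          \<open>\<theta>\<close>.\<close>
        have "deriv (add_mset (rn \<theta> \<psi>) (rns \<theta> S + Q))"
          using decomp.IH(1)[OF \<theta> Q] decomp.hyps(2)[OF \<theta> Q] by (simp add: S')
        then have "deriv (rns \<theta> S + Q + Q)"
          by (rule deriv_invert[OF _ decomp_rn[OF dec, of \<theta>]]) (simp add: Q)
        then show "deriv (rns \<theta> S + Q)"
          by (rule deriv_contract_mset[rotated])
            (use less.hyps decomp_weight[OF dec Q] decomp.prems(2) in simp)
      qed
    next
      case False
      then obtain K' where K': "S' = add_mset \<psi> K'" "add_mset \<psi> S = add_mset \<chi> K'"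
        using decomp.prems(1) by (metis add_eq_conv_ex)
      with False obtain K where "K' = add_mset \<psi> K" "S = add_mset \<chi> K"
        by (metis add_eq_conv_ex)
      with K' have K: "S' = add_mset \<psi> (add_mset \<psi> K)" "S = add_mset \<chi> K" by simp_all
      have "deriv (add_mset \<chi> (add_mset \<psi> K))"
      proof (rule deriv.decomp[OF decomp.hyps(1)])
        fix \<theta> :: "'b label \<Rightarrow> 'b label" and Q
        assume "\<theta> \<epsilon> = \<epsilon>" "Q \<in> F \<theta>"
        from decomp.IH[OF this, of "rn \<theta> \<psi>" "rns \<theta> K + Q"]
        show "deriv (rns \<theta> (add_mset \<psi> K) + Q)"
          using decomp.prems by (simp add: K ac_simps)
      qed
      then show ?thesis by (simp add: K add_mset_commute)
    qed
  next
    case (extend P F S')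
    show ?case
    proof (rule deriv.extend[OF extend.hyps(1)])
      \<comment> \<open>\<open>P\<close> is a set of items, so one copy serves as well as
        two.\<close>
      show "P \<subseteq> set_mset (add_mset \<psi> S)" using extend.hyps(2) extend.prems by simp
      fix \<theta> :: "'b label \<Rightarrow> 'b label" and Q
      assume "\<theta> \<epsilon> = \<epsilon>" "Q \<in> F \<theta>"
      from extend.IH[OF this, of "rn \<theta> \<psi>" "rns \<theta> S + Q"]
      show "deriv (rns \<theta> (add_mset \<psi> S) + Q)"
        using extend.prems by (simp add: ac_simps)
    qed
  qed
  then show ?case using less.prems by blast
qed

text \<open>Weaken by all of \<open>S'\<close>, then contract each item of \<open>S\<close> into its
  copy in \<open>S'\<close>.\<close>

lemma deriv_mono:
  assumes "deriv S" "set_mset S \<subseteq> set_mset S'"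
  shows "deriv S'"
proof -
  have "deriv (S' + S)" using deriv_weaken[OF assms(1), of S'] by (simp add: add.commute)
  then show ?thesis using assms(2)
  proof (induction S)
    case (add \<phi> S)
    then obtain K where K: "S' + S = add_mset \<phi> K"
      by (metis insert_subset mset_add set_mset_add_mset_insert union_iff)
    then show ?case using add deriv_contract[of \<phi> K] by simp
  qed simp
qed

section \<open>Admissibility of cut\<close>

text \<open>\<open>f x\<close> and \<open>g x\<close> are the two occurrences of the cut formula at
  label \<open>x\<close>. The cut moves up the derivation containing \<open>f x\<close>, while the
  other derivation follows by renaming; the label therefore varies. What remains is the hypothesis
  on \<open>extend\<close>, where \<open>f x\<close> is principal and the cut has already been made
  in the premises.\<close>

lemma deriv_cut_permute:
  fixes f g :: "'v label \<Rightarrow> ('p, 'v) item"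
  assumes rn: "\<And>\<theta> x. rn \<theta> (f x) = f (\<theta> x)" "\<And>\<theta> x. rn \<theta> (g x) = g (\<theta> x)"
    and "\<And>x F. \<not> decomp (f x) F"
    and ext: "\<And>x S X P F. extend P F \<Longrightarrow> f x \<in> P \<Longrightarrow> P \<subseteq> insert (f x) (set_mset S) \<Longrightarrow>
      (\<And>Q. Q \<in> F id \<Longrightarrow> deriv (S + X + Q)) \<Longrightarrow> deriv (add_mset (g x) X) \<Longrightarrow> deriv (S + X)"
    and "deriv (add_mset (f x) S)" "deriv (add_mset (g x) X)"
  shows "deriv (S + X)"
proof (rule deriv_replace[where M = "\<lambda>\<phi> X. \<exists>x. \<phi> = f x \<and> deriv (add_mset (g x) X)"])
  fix \<phi> :: "('p, 'v) item" and X and \<theta> :: "'v label \<Rightarrow> 'v label"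
  assume "\<exists>x. \<phi> = f x \<and> deriv (add_mset (g x) X)" and \<theta>: "\<theta> \<epsilon> = \<epsilon>"
  then obtain x where x: "\<phi> = f x" "deriv (add_mset (g x) X)" by blast
  show "\<exists>x. rn \<theta> \<phi> = f x \<and> deriv (add_mset (g x) (rns \<theta> X))"
    using deriv_rename[of _ \<theta>, OF x(2) \<theta>] x(1) rn by auto
next
  fix \<phi> X S P and F :: "('v label \<Rightarrow> 'v label) \<Rightarrow> ('p, 'v) item multiset set"
  assume "\<exists>x. \<phi> = f x \<and> deriv (add_mset (g x) X)" and e: "extend P F" "\<phi> \<in> P"
    "P \<subseteq> insert \<phi> (set_mset S)"
    and *: "\<And>\<theta> Q. \<theta> \<epsilon> = \<epsilon> \<Longrightarrow> Q \<in> F \<theta> \<Longrightarrow> deriv (rns \<theta> (S + X) + Q)"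
  then obtain x where x: "\<phi> = f x" "deriv (add_mset (g x) X)" by blast
  show "deriv (S + X)"
    by (rule ext[of P F x, OF _ _ _ _ x(2)]) (use e x *[of id] in auto)
qed (use assms in auto)

text \<open>For conjunction and implication both sides are inverted. Otherwise the cut is permuted
  on the side whose formula is not decomposed; when it becomes principal there, the other side is
  inverted if it can be, and the subformulas are cut by the induction hypothesis.\<close>

lemma deriv_cut: "deriv (add_mset (R x A) S) \<Longrightarrow> deriv (add_mset (L x A) X) \<Longrightarrow> deriv (S + X)"
proof (induction A arbitrary: x S X)
  case (Atom p)
  show ?case
  proof (rule deriv_cut_permute[where f = "\<lambda>x. R x (Atom p)"
      and g = "\<lambda>x. L x (Atom p)", OF _ _ _ _ Atom])
    fix x P and S X :: "('a, 'b) item multiset"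
      and F :: "('b label \<Rightarrow> 'b label) \<Rightarrow> ('a, 'b) item multiset set"
    assume "extend P F" "R x (Atom p) \<in> P" "P \<subseteq> insert (R x (Atom p)) (set_mset S)"
    \<comment> \<open>The rule is \<open>Id\<close>, whose other principal item lies in the
      context.\<close>
    then have "L x (Atom p) \<in># S" by cases auto
    moreover assume "deriv (add_mset (L x (Atom p)) X)"
    ultimately show "deriv (S + X)" by (rule_tac deriv_mono) auto
  qed (auto elim: decomp.cases)
next
  case Top
  \<comment> \<open>On the left \<open>Top\<close> is never principal, so the permuted cut simply
    vanishes.\<close>
  then have "deriv (X + S)"
    by (rule_tac deriv_cut_permute[where f = "\<lambda>x. L x \<^bold>\<top>" and g = "\<lambda>x. R x \<^bold>\<top>" and x = x])
      (auto elim: decomp.cases extend.cases)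
  then show ?case by (simp add: add.commute)
next
  case Bot
  then show ?case
    by (rule_tac deriv_cut_permute[where f = "\<lambda>x. R x \<^bold>\<bottom>" and g = "\<lambda>x. L x \<^bold>\<bottom>" and x = x])
      (auto elim: decomp.cases extend.cases)
next
  case (And A B)
  have "deriv (S + {#R x A#})" "deriv (S + {#R x B#})"
    by (rule deriv_invert[OF And.prems(1) decomp.AndR]; simp)+
  moreover have "deriv (X + {#L x A, L x B#})"
    by (rule deriv_invert[OF And.prems(2) decomp.AndL]) simp
  \<comment> \<open>Cut on \<open>A\<close>, then on \<open>B\<close>; the duplicate of
    \<open>S\<close> is contracted afterwards.\<close>
  ultimately have "deriv (S + (S + X))"
    using And.IH(1)[of x S "add_mset (L x B) X"] And.IH(2)[of x S "S + X"] by simp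
  then show ?case by (rule deriv_mono) auto
next
  case (Imp A B)
  have "deriv (S + {#L x A, R x B#})"
    by (rule deriv_invert[OF Imp.prems(1) decomp.ImpR]) simp
  moreover have "deriv (X + {#R x A#})" "deriv (X + {#L x B#})"
    by (rule deriv_invert[OF Imp.prems(2) decomp.ImpL]; simp)+
  ultimately have "deriv (X + S + X)"
    using Imp.IH(1)[of x X "add_mset (R x B) S"] Imp.IH(2)[of x "X + S" X] by simp
  then show ?case by (rule deriv_mono) auto
next
  case MTop
  show ?case
  proof (rule deriv_cut_permute[where f = "\<lambda>x. R x \<^bold>\<top>\<^sup>*"
      and g = "\<lambda>x. L x \<^bold>\<top>\<^sup>*", OF _ _ _ _ MTop])
    fix x P and S X :: "('a, 'b) item multiset"
      and F :: "('b label \<Rightarrow> 'b label) \<Rightarrow> ('a, 'b) item multiset set"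
    assume "extend P F" "R x \<^bold>\<top>\<^sup>* \<in> P" "P \<subseteq> insert (R x \<^bold>\<top>\<^sup>*) (set_mset S)"
    \<comment> \<open>The rule is \<open>MTopR\<close>. At \<open>\<epsilon>\<close> the left
      formula can be inverted away with an empty premise.\<close>
    then have "x = \<epsilon>" by cases auto
    moreover assume "deriv (add_mset (L x \<^bold>\<top>\<^sup>*) X)"
    ultimately have "deriv (X + {#})" using deriv_invert[OF _ decomp.MTopL, of x X "{#}"] by simp
    then show "deriv (S + X)" by (rule deriv_mono) auto
  qed (auto elim: decomp.cases)
next
  case (Star A B)
  show ?case
  proof (rule deriv_cut_permute[where f = "\<lambda>x. R x (A \<^bold>* B)"
      and g = "\<lambda>x. L x (A \<^bold>* B)", OF _ _ _ _ Star.prems])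
    fix z P and S X :: "('a, 'b) item multiset"
      and F :: "('b label \<Rightarrow> 'b label) \<Rightarrow> ('a, 'b) item multiset set"
    assume "extend P F" "R z (A \<^bold>* B) \<in> P" "P \<subseteq> insert (R z (A \<^bold>* B)) (set_mset S)"
      and *: "\<And>Q. Q \<in> F id \<Longrightarrow> deriv (S + X + Q)"
    then obtain x y where T: "T x y z \<in># S"
      and F: "F = (\<lambda>\<theta>. {{#R (\<theta> x) A#}, {#R (\<theta> y) B#}})"
      by cases auto
    assume "deriv (add_mset (L z (A \<^bold>* B)) X)"
    \<comment> \<open>Inversion offers all labels, so take the \<open>x\<close> and \<open>y\<close>
      that \<open>StarR\<close> used.\<close>
    then have "deriv (X + {#T x y z, L x A, L y B#})"
      by (rule deriv_invert[OF _ decomp.StarL]) auto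
    \<comment> \<open>Cuts on \<open>A\<close> and \<open>B\<close>. The extra atom is absorbed by
      its copy in \<open>S\<close>.\<close>
    then have "deriv (S + X + (S + X + add_mset (T x y z) X))"
      using *[of "{#R x A#}"] *[of "{#R y B#}"]
        Star.IH(1)[of x "S + X" "add_mset (L y B) (add_mset (T x y z) X)"]
        Star.IH(2)[of y "S + X" "S + X + add_mset (T x y z) X"]
      by (simp add: F add_mset_commute)
    then show "deriv (S + X)" by (rule deriv_mono) (use T in auto)
  qed (auto elim: decomp.cases)
next
  case (Wand A B)
  \<comment> \<open>For the wand it is the left formula that is kept by its rule, so the two
    derivations swap roles.\<close>
  have "deriv (X + S)"
  proof (rule deriv_cut_permute[where f = "\<lambda>x. L x (A \<^bold>-\<^bold>* B)"
      and g = "\<lambda>x. R x (A \<^bold>-\<^bold>* B)", OF _ _ _ _ Wand.prems(2,1)])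
    fix y P and S X :: "('a, 'b) item multiset"
      and F :: "('b label \<Rightarrow> 'b label) \<Rightarrow> ('a, 'b) item multiset set"
    assume "extend P F" "L y (A \<^bold>-\<^bold>* B) \<in> P" "P \<subseteq> insert (L y (A \<^bold>-\<^bold>* B)) (set_mset S)"
      and *: "\<And>Q. Q \<in> F id \<Longrightarrow> deriv (S + X + Q)"
    then obtain x z where T: "T x y z \<in># S"
      and F: "F = (\<lambda>\<theta>. {{#R (\<theta> x) A#}, {#L (\<theta> z) B#}})"
      by cases auto
    assume "deriv (add_mset (R y (A \<^bold>-\<^bold>* B)) X)"
    then have "deriv (X + {#T x y z, L x A, R z B#})"
      by (rule deriv_invert[OF _ decomp.WandR]) auto
    then have "deriv (S + X + add_mset (T x y z) X + (S + X))"
      using *[of "{#R x A#}"] *[of "{#L z B#}"]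
        Wand.IH(1)[of x "S + X" "add_mset (R z B) (add_mset (T x y z) X)"]
        Wand.IH(2)[of z "S + X + add_mset (T x y z) X" "S + X"]
      by (simp add: F add_mset_commute)
    then show "deriv (S + X)" by (rule deriv_mono) (use T in auto)
  qed (auto elim: decomp.cases)
  then show ?case by (simp add: add.commute)
qed

section \<open>Embedding of the original calculus\<close>

primrec left_item :: "('p, 'v) lform \<Rightarrow> ('p, 'v) item" where
  "left_item (w \<^bold>: A) = L w A"

primrec right_item :: "('p, 'v) lform \<Rightarrow> ('p, 'v) item" where
  "right_item (w \<^bold>: A) = R w A"

primrec ant_item :: "('p, 'v) ant \<Rightarrow> ('p, 'v) item" where
  "ant_item (Fm \<phi>) = left_item \<phi>"
| "ant_item \<lparr>x, y \<triangleright> z\<rparr> = T x y z"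

definition items :: "('v label \<Rightarrow> 'v label) \<Rightarrow> ('p, 'v) ant multiset \<Rightarrow>
    ('p, 'v) lform multiset \<Rightarrow> ('p, 'v) item multiset" where
  "items \<theta> \<Gamma> \<Delta> = rns \<theta> (image_mset ant_item \<Gamma> + image_mset right_item \<Delta>)"

lemma items_add [simp]:
  "items \<theta> (add_mset a \<Gamma>) \<Delta> = add_mset (rn \<theta> (ant_item a)) (items \<theta> \<Gamma> \<Delta>)"
  "items \<theta> \<Gamma> (add_mset b \<Delta>) = add_mset (rn \<theta> (right_item b)) (items \<theta> \<Gamma> \<Delta>)"
  by (simp_all add: items_def)

lemma items_plus: "items \<theta> (\<Gamma> + \<Gamma>') (\<Delta> + \<Delta>') = items \<theta> \<Gamma> \<Delta> + items \<theta> \<Gamma>' \<Delta>'"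
  by (simp add: items_def ac_simps)

lemma rns_items [simp]: "rns \<eta> (items \<theta> \<Gamma> \<Delta>) = items (\<eta> \<circ> \<theta>) \<Gamma> \<Delta>"
  by (simp add: items_def multiset.map_comp comp_def)

lemma ant_item_subst: "ant_item (subst_ant y x a) = rn (subst_label y x) (ant_item a)"
proof (cases a)
  case (Fm \<phi>)
  then show ?thesis by (cases \<phi>) simp
qed simp

lemma right_item_subst: "right_item (subst_lform y x b) = rn (subst_label y x) (right_item b)"
  by (cases b) simp

text \<open>A map that identifies \<open>x\<close> and \<open>y\<close> does not see the
  substitution. This turns the premises of the substituting rules into premises at restricted
  maps.\<close>

lemma items_subst:
  assumes "\<theta> x = \<theta> y"
  shows "items \<theta> (\<Gamma>[y/x]\<^sub>L) (\<Delta>[y/x]\<^sub>R) = items \<theta> \<Gamma> \<Delta>"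
proof -
  have "\<theta> \<circ> subst_label y x = \<theta>" using assms by (auto simp: subst_label_def)
  then show ?thesis
    by (simp add: items_def multiset.map_comp comp_def ant_item_subst right_item_subst)
qed

lemma items_cong:
  assumes "\<And>l. l \<in> seq_labels \<Gamma> \<Delta> \<Longrightarrow> \<theta> l = \<theta>' l"
  shows "items \<theta> \<Gamma> \<Delta> = items \<theta>' \<Gamma> \<Delta>"
proof -
  have "rn \<theta> (ant_item a) = rn \<theta>' (ant_item a)" if "a \<in># \<Gamma>" for a
  proof -
    have "\<theta> l = \<theta>' l" if "l \<in> ant_labels a" for l
      using assms \<open>a \<in># \<Gamma>\<close> that by (auto simp: seq_labels_def)
    then show ?thesis
    proof (cases a)
      case (Fm \<phi>)
      then show ?thesis using \<open>\<And>l. l \<in> ant_labels a \<Longrightarrow> \<theta> l = \<theta>' l\<close> by (cases \<phi>) simp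
    qed simp
  qed
  moreover have "rn \<theta> (right_item b) = rn \<theta>' (right_item b)" if "b \<in># \<Delta>" for b
    using assms that by (cases b) (force simp: seq_labels_def)
  ultimately show ?thesis
    by (simp add: items_def multiset.map_comp comp_def cong: image_mset_cong)
qed

lemma seq_labels_add [simp]:
  "seq_labels (add_mset a \<Gamma>) \<Delta> = ant_labels a \<union> seq_labels \<Gamma> \<Delta>"
  "seq_labels \<Gamma> (add_mset b \<Delta>) = lform_labels b \<union> seq_labels \<Gamma> \<Delta>"
  by (auto simp: seq_labels_def)

text \<open>Redirecting a fresh variable lets an eigenvariable stand for any label without
  disturbing the context.\<close>

lemma items_fresh [simp]:
  "x \<notin> seq_labels \<Gamma> \<Delta> \<Longrightarrow> items (\<theta>(x := y)) \<Gamma> \<Delta> = items \<theta> \<Gamma> \<Delta>"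
  by (rule items_cong) auto

\<comment> \<open>The induction hypotheses below are eta-expanded, which unfolds \<open>fun_upd\<close>.\<close>
lemmas items_fresh' [simp] = items_fresh [unfolded fun_upd_def]

text \<open>A premise owed at \<open>\<eta>\<close> is the induction hypothesis at
  \<open>\<eta> \<circ> \<theta>\<close>, updated at the eigenvariables; hence the general
  \<open>\<theta>\<close>.\<close>

lemma derivable_imp_deriv: "derivable c \<Gamma> \<Delta> \<Longrightarrow> \<theta> \<epsilon> = \<epsilon> \<Longrightarrow> deriv (items \<theta> \<Gamma> \<Delta>)"
proof (induction arbitrary: \<theta> rule: derivable.induct)
  case (Id w P \<Gamma> \<Delta>)
  show ?case by (rule deriv.extend[OF extend.Id, of "\<theta> w" P]) auto
next
  case (BotL w \<Gamma> \<Delta>)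
  show ?case by (simp, rule deriv.decomp[OF decomp.BotL]) auto
next
  case (TopR \<Gamma> w \<Delta>)
  show ?case by (simp, rule deriv.decomp[OF decomp.TopR]) auto
next
  case (MTopR \<Gamma> \<Delta>)
  show ?case by (rule deriv.extend[OF extend.MTopR]) (use MTopR in auto)
next
  case (Cut \<Gamma> x A \<Delta> \<Gamma>' \<Delta>')
  then show ?case using deriv_cut[of "\<theta> x" A] by (simp add: items_plus)
next
  case (MTopL \<Gamma> w \<Delta>)
  have *: "deriv (items (\<eta> \<circ> \<theta>) \<Gamma> \<Delta>)" if "\<eta> \<epsilon> = \<epsilon>" "\<eta> (\<theta> (LVar w)) = \<epsilon>" for \<eta>
    using MTopL.IH[of "\<eta> \<circ> \<theta>"] MTopL.prems that items_subst[of "\<eta> \<circ> \<theta>" "LVar w" \<epsilon> \<Gamma> \<Delta>]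
    by (simp add: comp_def)
  show ?case by (simp, rule deriv.decomp[OF decomp.MTopL]) (use * in auto)
next
  case (AndL w A B \<Gamma> \<Delta>)
  show ?case
    by (simp, rule deriv.decomp[OF decomp.AndL])
      (use AndL.IH[of "\<eta> \<circ> \<theta>" for \<eta>] AndL.prems in \<open>auto simp: comp_def add_mset_commute\<close>)
next
  case (AndR \<Gamma> w A \<Delta> B)
  show ?case
    by (simp, rule deriv.decomp[OF decomp.AndR])
      (use AndR.IH(1)[of "\<eta> \<circ> \<theta>" for \<eta>]
          AndR.IH(2)[of "\<eta> \<circ> \<theta>" for \<eta>] AndR.prems
        in \<open>auto simp: comp_def add_mset_commute\<close>)
next
  case (ImpL \<Gamma> w A \<Delta> B)
  show ?case
    by (simp, rule deriv.decomp[OF decomp.ImpL])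
      (use ImpL.IH(1)[of "\<eta> \<circ> \<theta>" for \<eta>]
          ImpL.IH(2)[of "\<eta> \<circ> \<theta>" for \<eta>] ImpL.prems
        in \<open>auto simp: comp_def add_mset_commute\<close>)
next
  case (ImpR w A \<Gamma> B \<Delta>)
  show ?case
    by (simp, rule deriv.decomp[OF decomp.ImpR])
      (use ImpR.IH[of "\<eta> \<circ> \<theta>" for \<eta>] ImpR.prems in \<open>auto simp: comp_def add_mset_commute\<close>)
next
  case (StarL x y z A B \<Gamma> \<Delta>)
  have *: "deriv (add_mset (T x' y' (\<eta> (\<theta> z))) (add_mset (L x' A) (add_mset (L y' B)
      (items (\<eta> \<circ> \<theta>) \<Gamma> \<Delta>))))" if "\<eta> \<epsilon> = \<epsilon>" for \<eta> x' y'
    using StarL.IH[of "(\<eta> \<circ> \<theta>)(LVar x := x', LVar y := y')"] StarL.hyps StarL.prems that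
    by (auto simp: comp_def)
  show ?case
    by (simp, rule deriv.decomp[OF decomp.StarL]) (use * in \<open>auto simp: comp_def add_mset_commute\<close>)
next
  case (WandR x y z A \<Gamma> B \<Delta>)
  have *: "deriv (add_mset (T x' (\<eta> (\<theta> y)) z') (add_mset (L x' A) (add_mset (R z' B)
      (items (\<eta> \<circ> \<theta>) \<Gamma> \<Delta>))))" if "\<eta> \<epsilon> = \<epsilon>" for \<eta> x' z'
    using WandR.IH[of "(\<eta> \<circ> \<theta>)(LVar x := x', LVar z := z')"] WandR.hyps WandR.prems that
    by (auto simp: comp_def add_mset_commute)
  show ?case
    by (simp, rule deriv.decomp[OF decomp.WandR]) (use * in \<open>auto simp: comp_def add_mset_commute\<close>)
next
  case (StarR x y z \<Gamma> A B \<Delta>)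
  show ?case
    by (rule deriv.extend[OF extend.StarR, of "\<theta> x" "\<theta> y" "\<theta> z" A B])
      (use StarR.prems StarR.IH(1)[of "\<eta> \<circ> \<theta>" for \<eta>]
          StarR.IH(2)[of "\<eta> \<circ> \<theta>" for \<eta>]
        in \<open>auto simp: comp_def add_mset_commute\<close>)
next
  case (WandL x y z A B \<Gamma> \<Delta>)
  show ?case
    by (rule deriv.extend[OF extend.WandL, of "\<theta> x" "\<theta> y" "\<theta> z" A B])
      (use WandL.prems WandL.IH(1)[of "\<eta> \<circ> \<theta>" for \<eta>]
          WandL.IH(2)[of "\<eta> \<circ> \<theta>" for \<eta>]
        in \<open>auto simp: comp_def add_mset_commute\<close>)
next
  case (E y x z \<Gamma> \<Delta>)
  show ?case
    by (rule deriv.extend[OF extend.E, of "\<theta> x" "\<theta> y" "\<theta> z"])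
      (use E.prems E.IH[of "\<eta> \<circ> \<theta>" for \<eta>] in \<open>auto simp: comp_def add_mset_commute\<close>)
next
  case (U x \<Gamma> \<Delta>)
  show ?case
    by (rule deriv.extend[OF extend.U, of _ "\<theta> x"])
      (use U.prems U.IH[of "\<eta> \<circ> \<theta>" for \<eta>] in \<open>auto simp: comp_def\<close>)
next
  case (A u w z y v x \<Gamma> \<Delta>)
  have *: "deriv (add_mset (T (\<eta> (\<theta> u)) w' (\<eta> (\<theta> z))) (add_mset (T (\<eta> (\<theta> y)) (\<eta> (\<theta> v)) w')
      (items (\<eta> \<circ> \<theta>) (add_mset \<lparr>x, y \<triangleright> z\<rparr> (add_mset \<lparr>u, v \<triangleright> x\<rparr> \<Gamma>)) \<Delta>)))"
    if "\<eta> \<epsilon> = \<epsilon>" for \<eta> w'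
    using A.IH[of "(\<eta> \<circ> \<theta>)(LVar w := w')"] A.hyps A.prems that by (auto simp: comp_def)
  show ?case
    by (rule deriv.extend[OF extend.A, of "\<theta> x" "\<theta> y" "\<theta> z" "\<theta> u" "\<theta> v"])
      (use * in \<open>auto simp: comp_def add_mset_commute\<close>)
next
  case (A_C x w y \<Gamma> \<Delta>)
  have *: "deriv (add_mset (T (\<eta> (\<theta> x)) w' (\<eta> (\<theta> x))) (add_mset (T (\<eta> (\<theta> y)) (\<eta> (\<theta> y)) w')
      (items (\<eta> \<circ> \<theta>) (add_mset \<lparr>x, y \<triangleright> x\<rparr> \<Gamma>) \<Delta>)))"
    if "\<eta> \<epsilon> = \<epsilon>" for \<eta> w'
    using A_C.IH[of "(\<eta> \<circ> \<theta>)(LVar w := w')"] A_C.hyps A_C.prems that by (auto simp: comp_def)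
  \<comment> \<open>The single atom serves as both principal atoms of
    \<open>extend.A\<close>.\<close>
  show ?case
    by (rule deriv.extend[OF extend.A, of "\<theta> x" "\<theta> y" "\<theta> x" "\<theta> x" "\<theta> y"])
      (use * in \<open>auto simp: comp_def add_mset_commute\<close>)
next
  case (Eq1 w' \<Gamma> w \<Delta>)
  \<comment> \<open>Once \<open>\<eta>\<close> identifies the two labels, the principal atom itself
    becomes the atom in the premise of \<open>Eq1\<close>.\<close>
  have *: "deriv (add_mset (T \<epsilon> (\<eta> (\<theta> w')) (\<eta> (\<theta> w'))) (items (\<eta> \<circ> \<theta>) \<Gamma> \<Delta>))"
    if "\<eta> \<epsilon> = \<epsilon>" "\<eta> (\<theta> (LVar w)) = \<eta> (\<theta> w')" for \<eta>
    using Eq1.IH[of "\<eta> \<circ> \<theta>"] Eq1.prems that items_subst[of "\<eta> \<circ> \<theta>" "LVar w" w' \<Gamma> \<Delta>]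
    by (simp add: comp_def)
  show ?case
    by (rule deriv.extend[OF extend.Eq, of "\<theta> (LVar w)" "\<theta> w'"]) (use * Eq1.prems in auto)
next
  case (Eq2 w' \<Gamma> w \<Delta>)
  have *: "deriv (add_mset (T \<epsilon> (\<eta> (\<theta> (LVar w))) (\<eta> (\<theta> (LVar w)))) (items (\<eta> \<circ> \<theta>) \<Gamma> \<Delta>))"
    if "\<eta> \<epsilon> = \<epsilon>" "\<eta> (\<theta> w') = \<eta> (\<theta> (LVar w))" for \<eta>
    using Eq2.IH[of "\<eta> \<circ> \<theta>"] Eq2.prems that items_subst[of "\<eta> \<circ> \<theta>" "LVar w" w' \<Gamma> \<Delta>]
    by (simp add: comp_def)
  show ?case
    by (rule deriv.extend[OF extend.Eq, of "\<theta> w'" "\<theta> (LVar w)"]) (use * Eq2.prems in auto)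
qed

section \<open>Return to the original calculus without cut\<close>

primrec ante :: "('p, 'v) item \<Rightarrow> ('p, 'v) ant multiset" where
  "ante (L w A) = {#Fm (w \<^bold>: A)#}"
| "ante (R w A) = {#}"
| "ante (T x y z) = {#\<lparr>x, y \<triangleright> z\<rparr>#}"

primrec succ :: "('p, 'v) item \<Rightarrow> ('p, 'v) lform multiset" where
  "succ (L w A) = {#}"
| "succ (R w A) = {#w \<^bold>: A#}"
| "succ (T x y z) = {#}"

abbreviation antes :: "('p, 'v) item multiset \<Rightarrow> ('p, 'v) ant multiset" where
  "antes S \<equiv> \<Sum>\<^sub># (image_mset ante S)"

abbreviation succs :: "('p, 'v) item multiset \<Rightarrow> ('p, 'v) lform multiset" where
  "succs S \<equiv> \<Sum>\<^sub># (image_mset succ S)"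

lemma antes_items [simp]: "antes (items id \<Gamma> \<Delta>) = \<Gamma>"
proof -
  have "ante (ant_item a) = {#a#}" for a :: "('a, 'b) ant"
    by (cases a) (auto split: lform.split simp: lform.split, case_tac x1, simp)
  moreover have "ante (right_item b) = {#}" for b :: "('a, 'b) lform" by (cases b) simp
  ultimately show ?thesis by (simp add: items_def multiset.map_comp comp_def)
qed

lemma succs_items [simp]: "succs (items id \<Gamma> \<Delta>) = \<Delta>"
proof -
  have "succ (ant_item a) = {#}" for a :: "('a, 'b) ant"
    by (cases a) (auto, case_tac x1, simp)
  moreover have "succ (right_item b) = {#b#}" for b :: "('a, 'b) lform" by (cases b) simp
  ultimately show ?thesis by (simp add: items_def multiset.map_comp comp_def)
qed

lemma antes_subst: "antes (rns (subst_label y x) S) = (antes S)[y/x]\<^sub>L"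
proof (induction S)
  case (add \<phi> S)
  then show ?case by (cases \<phi>) simp_all
qed simp

lemma succs_subst: "succs (rns (subst_label y x) S) = (succs S)[y/x]\<^sub>R"
proof (induction S)
  case (add \<phi> S)
  then show ?case by (cases \<phi>) simp_all
qed simp

lemma finite_lform_labels: "finite (lform_labels \<phi>)"
  by (cases \<phi>) simp

lemma finite_ant_labels: "finite (ant_labels a)"
  by (cases a) (simp_all add: finite_lform_labels)

lemma finite_seq_labels: "finite (seq_labels \<Gamma> \<Delta>)"
  by (simp add: seq_labels_def finite_lform_labels finite_ant_labels)

lemma fresh_label:
  fixes X :: "'v::infinite label set"
  assumes "finite X"
  obtains x where "LVar x \<notin> X"
proof -
  have "finite (LVar -` X)" using assms by (simp add: finite_vimageI inj_def)
  then have "LVar -` X \<noteq> UNIV" using infinite_UNIV by metis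
  then show thesis using that by blast
qed

lemma fresh_labels2:
  fixes X :: "'v::infinite label set"
  assumes "finite X"
  obtains x y where "x \<noteq> y" "LVar x \<notin> X" "LVar y \<notin> X"
proof -
  obtain x where x: "LVar x \<notin> X" using fresh_label[OF assms] .
  obtain y where "LVar y \<notin> insert (LVar x) X" using fresh_label[of "insert (LVar x) X"] assms by auto
  then show thesis using that[of x y] x by auto
qed

lemma deriv_imp_cut_free:
  fixes S :: "('p, 'v::infinite) item multiset"
  \<comment> \<open>The extra copies absorb \<open>\<top>\<^sup>*L\<close> with label \<open>\<epsilon>\<close>, which is not a rule of the original calculus.\<close>
  shows "deriv S \<Longrightarrow>
    LS_BBI_cut_free (antes S + replicate_mset n (Fm (\<epsilon> \<^bold>: \<^bold>\<top>\<^sup>*))) (succs S)"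
proof (induction arbitrary: n rule: deriv.induct)
  case (decomp \<phi> F S)
  let ?\<Gamma> = "antes S + replicate_mset n (Fm (\<epsilon> \<^bold>: \<^bold>\<top>\<^sup>*))" and ?\<Delta> = "succs S"
  \<comment> \<open>Only \<open>MTopL\<close> and \<open>Eq\<close> use premises at maps other than
    \<open>id\<close>.\<close>
  have IH: "LS_BBI_cut_free (antes Q + ?\<Gamma>) (succs Q + ?\<Delta>)" if "Q \<in> F id" for Q
    using decomp.IH[of id Q n] that by (simp add: ac_simps)
  from decomp.hyps(1) show ?case
  proof cases
    case (BotL w)
    then show ?thesis by (simp add: derivable.BotL)
  next
    case (TopR w)
    then show ?thesis by (simp add: derivable.TopR)
  next
    case (MTopL w)
    show ?thesis
    proof (cases w)
      case Eps
      \<comment> \<open>The premise lacks the principal formula; one more extra copy restores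
        it.\<close>
      then show ?thesis using decomp.IH[of id "{#}" "Suc n"] MTopL by simp
    next
      case (LVar v)
      \<comment> \<open>The substitution is the most general map sending \<open>LVar v\<close> to
        \<open>\<epsilon>\<close>.\<close>
      have "LS_BBI_cut_free (?\<Gamma>[\<epsilon>/LVar v]\<^sub>L) (?\<Delta>[\<epsilon>/LVar v]\<^sub>R)"
        using decomp.IH[of "subst_label \<epsilon> (LVar v)" "{#}" n]
        by (simp add: MTopL LVar subst_label_def antes_subst succs_subst)
      then show ?thesis using MTopL LVar by (simp add: derivable.MTopL)
    qed
  next
    case (AndL w A B)
    then show ?thesis
      using IH derivable.AndL[of False w A B ?\<Gamma> ?\<Delta>] by (simp add: add_mset_commute)
  next
    case (AndR w A B)
    then show ?thesis using IH[of "{#R w A#}"] IH[of "{#R w B#}"] by (simp add: derivable.AndR)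
  next
    case (ImpL w A B)
    then show ?thesis using IH[of "{#R w A#}"] IH[of "{#L w B#}"] by (simp add: derivable.ImpL)
  next
    case (ImpR w A B)
    then show ?thesis using IH by (simp add: derivable.ImpR)
  next
    case (StarL z A B)
    obtain x y where "x \<noteq> y"
      "LVar x \<notin> insert z (seq_labels ?\<Gamma> ?\<Delta>)" "LVar y \<notin> insert z (seq_labels ?\<Gamma> ?\<Delta>)"
      by (rule fresh_labels2[OF finite.insertI[OF finite_seq_labels]])
    moreover have "{#T (LVar x) (LVar y) z, L (LVar x) A, L (LVar y) B#} \<in> F id"
      unfolding StarL(2) by auto
    ultimately show ?thesis
      using IH[of "{#T (LVar x) (LVar y) z, L (LVar x) A, L (LVar y) B#}"] StarL(1)
        derivable.StarL[of False x y z A B ?\<Gamma> ?\<Delta>] by (simp add: add_mset_commute)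
  next
    case (WandR y A B)
    obtain x z where "x \<noteq> z"
      "LVar x \<notin> insert y (seq_labels ?\<Gamma> ?\<Delta>)" "LVar z \<notin> insert y (seq_labels ?\<Gamma> ?\<Delta>)"
      by (rule fresh_labels2[OF finite.insertI[OF finite_seq_labels]])
    moreover have "{#T (LVar x) y (LVar z), L (LVar x) A, R (LVar z) B#} \<in> F id"
      unfolding WandR(2) by auto
    ultimately show ?thesis
      using IH[of "{#T (LVar x) y (LVar z), L (LVar x) A, R (LVar z) B#}"] WandR(1)
        derivable.WandR[of False x y z A ?\<Gamma> B ?\<Delta>] by (simp add: add_mset_commute)
  qed
next
  case (extend P F S)
  let ?\<Gamma> = "antes S + replicate_mset n (Fm (\<epsilon> \<^bold>: \<^bold>\<top>\<^sup>*))" and ?\<Delta> = "succs S"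
  have IH: "LS_BBI_cut_free (antes Q + ?\<Gamma>) (succs Q + ?\<Delta>)" if "Q \<in> F id" for Q
    using extend.IH[of id Q n] that by (simp add: ac_simps)
  have mem: "\<exists>S'. S = add_mset \<phi> S'" if "\<phi> \<in> P" for \<phi>
    using extend.hyps(2) that by (meson mset_add subsetD)
  have mem2: "\<exists>S'. S = add_mset \<phi> (add_mset \<psi> S')" if "\<phi> \<in> P" "\<psi> \<in> P" "\<phi> \<noteq> \<psi>" for \<phi> \<psi>
    using extend.hyps(2) that by (metis insert_noteq_member mset_add subsetD)
  from extend.hyps(1) show ?case
  proof cases
    case (Id w p)
    with mem2[of "L w (Atom p)" "R w (Atom p)"] show ?thesis
      by (auto intro: derivable.Id)
  next
    case MTopR
    with mem show ?thesis by (auto intro: derivable.MTopR)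
  next
    case (StarR x y z A B)
    with mem2[of "T x y z" "R z (A \<^bold>* B)"] obtain S'
      where S: "S = add_mset (T x y z) (add_mset (R z (A \<^bold>* B)) S')" by auto
    let ?\<Gamma>' = "antes S' + replicate_mset n (Fm (\<epsilon> \<^bold>: \<^bold>\<top>\<^sup>*))"
    show ?thesis
      using IH[of "{#R x A#}"] IH[of "{#R y B#}"] StarR(2) S
        derivable.StarR[of False x y z ?\<Gamma>' A B "succs S'"] by (simp add: add_mset_commute)
  next
    case (WandL x y z A B)
    with mem2[of "T x y z" "L y (A \<^bold>-\<^bold>* B)"] obtain S'
      where S: "S = add_mset (T x y z) (add_mset (L y (A \<^bold>-\<^bold>* B)) S')" by auto
    let ?\<Gamma>' = "antes S' + replicate_mset n (Fm (\<epsilon> \<^bold>: \<^bold>\<top>\<^sup>*))"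
    show ?thesis
      using IH[of "{#R x A#}"] IH[of "{#L z B#}"] WandL(2) S
        derivable.WandL[of False x y z A B ?\<Gamma>' "succs S'"] by (simp add: add_mset_commute)
  next
    case (E x y z)
    with mem[of "T x y z"] obtain S' where S: "S = add_mset (T x y z) S'" by auto
    show ?thesis
      using IH[of "{#T y x z#}"] E(2) S
        derivable.E[of False y x z "antes S' + replicate_mset n (Fm (\<epsilon> \<^bold>: \<^bold>\<top>\<^sup>*))"]
      by (simp add: add_mset_commute)
  next
    case (U x)
    then show ?thesis using IH[of "{#T x \<epsilon> x#}"] by (simp add: derivable.U)
  next
    case (A x y z u v)
    obtain w where w: "LVar w \<notin> seq_labels ?\<Gamma> ?\<Delta>"
      using fresh_label[OF finite_seq_labels] .
    have "{#T u (LVar w) z, T y v (LVar w)#} \<in> F id"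
      unfolding A(2) by auto
    then have prem: "LS_BBI_cut_free
        (add_mset \<lparr>u, LVar w \<triangleright> z\<rparr> (add_mset \<lparr>y, v \<triangleright> LVar w\<rparr> ?\<Gamma>)) ?\<Delta>"
      using IH[of "{#T u (LVar w) z, T y v (LVar w)#}"] by (simp add: add_mset_commute)
    \<comment> \<open>If the two principal atoms coincide, \<open>S\<close> may hold only one copy;
      then \<open>u = x\<close>, \<open>v = y\<close> and \<open>z = x\<close>, so
      \<open>A_C\<close> applies.\<close>
    show ?thesis
    proof (cases "T x y z = T u v x")
      case True
      with A(1) mem[of "T x y z"] obtain S' where "S = add_mset (T x y z) S'" by auto
      with prem w True show ?thesis
        using derivable.A_C[of False x w y "antes S' + replicate_mset n (Fm (\<epsilon> \<^bold>: \<^bold>\<top>\<^sup>*))"]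
        by (simp add: add_mset_commute)
    next
      case False
      with A(1) mem2[of "T x y z" "T u v x"] obtain S'
        where "S = add_mset (T x y z) (add_mset (T u v x) S')" by auto
      with prem w show ?thesis
        using derivable.A[of False u w z y v x
            "antes S' + replicate_mset n (Fm (\<epsilon> \<^bold>: \<^bold>\<top>\<^sup>*))"]
        by (simp add: add_mset_commute)
    qed
  next
    case (Eq w w')
    with mem[of "T \<epsilon> w w'"] obtain S' where S: "S = add_mset (T \<epsilon> w w') S'" by auto
    let ?\<Gamma>' = "antes S' + replicate_mset n (Fm (\<epsilon> \<^bold>: \<^bold>\<top>\<^sup>*))"
    \<comment> \<open>Any substitution for a variable that identifies \<open>w\<close> and
      \<open>w'\<close> is an admissible map: replace \<open>w\<close> if it is a variable
      (\<open>Eq1\<close>), else \<open>w'\<close> (\<open>Eq2\<close>).\<close>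
    have prem: "LS_BBI_cut_free (?\<Gamma>[y/LVar x]\<^sub>L) (?\<Delta>[y/LVar x]\<^sub>R)"
      if "subst_label y (LVar x) w = subst_label y (LVar x) w'" for x y
      using extend.IH[of "subst_label y (LVar x)" "{#}" n] that
      by (simp add: Eq subst_label_def antes_subst succs_subst)
    show ?thesis
    proof (cases w)
      case (LVar u)
      then show ?thesis
        using prem[of w' u] derivable.Eq1[of False w' u ?\<Gamma>' "succs S'"] S
        by (simp add: subst_label_def split: if_splits)
    next
      case Eps
      show ?thesis
      proof (cases w')
        case (LVar u)
        then show ?thesis
          using prem[of w u] derivable.Eq2[of False w u ?\<Gamma>' "succs S'"] S Eps
          by (simp add: subst_label_def)
      next
        case Eps
        \<comment> \<open>Both labels are \<open>\<epsilon>\<close>, so \<open>id\<close> qualifies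
          and its premise is already the conclusion.\<close>
        then show ?thesis using IH[of "{#}"] \<open>w = \<epsilon>\<close> Eq(2) by simp
      qed
    qed
  qed
qed

theorem theorem3:
  fixes \<Gamma> :: "('p, 'v::infinite) ant multiset"
    and \<Delta> :: "('p, 'v) lform multiset"
  assumes "LS_BBI \<Gamma> \<Delta>"
  shows "LS_BBI_cut_free \<Gamma> \<Delta>"
  using deriv_imp_cut_free[OF derivable_imp_deriv[OF assms, of id], of 0] by simp

end
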